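(* Let $\{Q_p(x)\}_{p\ge0}$ be a sequence of orthogonal polynomials given by a Favard recurrence with coefficients $A_p,B_p,C_p$ as in the context, so that $Q_{p+s}(x)=\Psi_{p+s}^{(p)}(x)Q_p(x)+\Psi_{p+s}^{(p-1)}(x)Q_{p-1}(x)$ for $p,s\ge1$, with the coefficient functions $\Psi$ defined in the context. Let $p\ge1$ be an integer. Then: (a) for every $s\ge1$, no real $x$ satisfies both $\Psi_{p+s}^{(p)}(x)=0$ and $\Psi_{p+s}^{(p-1)}(x)=0$; (b) for every $s\ge2$, no real $x$ satisfies both $\Psi_{p+s-1}^{(p)}(x)=0$ and $\Psi_{p+s}^{(p)}(x)=0$; (c) for every $s\ge2$, no real $x$ satisfies both $\Psi_{p+s-1}^{(p-1)}(x)=0$ and $\Psi_{p+s}^{(p-1)}(x)=0$.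
   Context: The sequence satisfies $Q_{p+1}(x)=(A_px+B_p)Q_p(x)-C_pQ_{p-1}(x)$ for $p\ge0$, with $Q_0(x)=1$, $Q_{-1}(x)=0$, where $(A_p),(B_p),(C_p)$ are real sequences with $A_p\ne0$ for all $p\ge 0$, and $C_p\neq 0$ and $C_pA_pA_{p-1}>0$ for all $p\ge 1$ ($C_0$ is irrelevant since $Q_{-1}=0$). Put $S_i(x)=A_ix+B_i$ for $i\ge1$. For fixed $p\ge1$, the functions $\Psi_{p+s}^{(p)},\Psi_{p+s}^{(p-1)}$ ($s\ge1$) are defined by $\Psi_{p+1}^{(p)}(x)=S_p(x)$, $\Psi_{p+1}^{(p-1)}(x)=-C_p$; $\Psi_{p+2}^{(p)}(x)=S_{p+1}(x)S_p(x)-C_{p+1}$, $\Psi_{p+2}^{(p-1)}(x)=-C_pS_{p+1}(x)$; and for $s\ge3$ and each $j\in\{p,p-1\}$, $\Psi_{p+s}^{(j)}(x)=S_{p+s-1}(x)\Psi_{p+s-1}^{(j)}(x)-C_{p+s-1}\Psi_{p+s-2}^{(j)}(x)$. *)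

theory Defs
  imports Complex_Main "HOL-Computational_Algebra.Polynomial"
begin

text \<open>The index of \<open>Q\<close> is an integer only so that the convention \<open>Q (-1) = 0\<close> can be stated;
  the values of \<open>Q\<close> below \<open>-1\<close> play no role.\<close>

definition favard_recurrence ::
    "(nat \<Rightarrow> real) \<Rightarrow> (nat \<Rightarrow> real) \<Rightarrow> (nat \<Rightarrow> real) \<Rightarrow> (int \<Rightarrow> real poly) \<Rightarrow> bool" where
  "favard_recurrence A B C Q \<longleftrightarrow>
     Q (-1) = 0 \<and> Q 0 = 1 \<and>
     (\<forall>p::nat. Q (int p + 1) = [:B p, A p:] * Q (int p) - smult (C p) (Q (int p - 1)))"

definition S :: "(nat \<Rightarrow> real) \<Rightarrow> (nat \<Rightarrow> real) \<Rightarrow> nat \<Rightarrow> real \<Rightarrow> real" where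
  "S A B i x = A i * x + B i"

text \<open>\<open>Psi_cur A B C p s\<close> is \<open>\<Psi>\<close> with lower index \<open>p + s\<close> and upper index \<open>(p)\<close>;
  \<open>Psi_prev A B C p s\<close> has the upper index \<open>(p - 1)\<close> instead.
  Only \<open>s \<ge> 1\<close> is meaningful; the values at \<open>s = 0\<close> are those of the trivial identity
  \<open>Q p = 1 * Q p + 0 * Q (p - 1)\<close>, and no other equation refers to them.\<close>

fun Psi_cur ::
    "(nat \<Rightarrow> real) \<Rightarrow> (nat \<Rightarrow> real) \<Rightarrow> (nat \<Rightarrow> real) \<Rightarrow> nat \<Rightarrow> nat \<Rightarrow> real \<Rightarrow> real" where
  "Psi_cur A B C p 0 x = 1"
| "Psi_cur A B C p (Suc 0) x = S A B p x"
| "Psi_cur A B C p (Suc (Suc 0)) x = S A B (p + 1) x * S A B p x - C (p + 1)"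
| "Psi_cur A B C p (Suc (Suc (Suc s))) x =
     S A B (p + s + 2) x * Psi_cur A B C p (Suc (Suc s)) x
     - C (p + s + 2) * Psi_cur A B C p (Suc s) x"

fun Psi_prev ::
    "(nat \<Rightarrow> real) \<Rightarrow> (nat \<Rightarrow> real) \<Rightarrow> (nat \<Rightarrow> real) \<Rightarrow> nat \<Rightarrow> nat \<Rightarrow> real \<Rightarrow> real" where
  "Psi_prev A B C p 0 x = 0"
| "Psi_prev A B C p (Suc 0) x = - C p"
| "Psi_prev A B C p (Suc (Suc 0)) x = - C p * S A B (p + 1) x"
| "Psi_prev A B C p (Suc (Suc (Suc s))) x =
     S A B (p + s + 2) x * Psi_prev A B C p (Suc (Suc s)) x
     - C (p + s + 2) * Psi_prev A B C p (Suc s) x"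

lemma favard_recurrence_poly:
  assumes "favard_recurrence A B C Q"
  shows "poly (Q (int p + 1)) x = S A B p x * poly (Q (int p)) x - C p * poly (Q (int p - 1)) x"
proof -
  have "Q (int p + 1) = [:B p, A p:] * Q (int p) - smult (C p) (Q (int p - 1))"
    using assms unfolding favard_recurrence_def by blast
  then show ?thesis
    by (simp only: poly_diff poly_mult poly_smult S_def) (simp add: algebra_simps)
qed

lemma favard_recurrence_Psi:
  assumes "favard_recurrence A B C Q" and "s \<ge> 1"
  shows "poly (Q (int (p + s))) x =
    Psi_cur A B C p s x * poly (Q (int p)) x + Psi_prev A B C p s x * poly (Q (int p - 1)) x"
proof -
  note rec = favard_recurrence_poly[OF assms(1), where x = x]
  have step1: "poly (Q (int (p + 1))) x = S A B p x * poly (Q (int p)) x - C p * poly (Q (int p - 1)) x"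
    using rec[of p] by (simp add: add.commute)
  have step: "poly (Q (int (p + n + 2))) x =
      S A B (p + n + 1) x * poly (Q (int (p + n + 1))) x - C (p + n + 1) * poly (Q (int (p + n))) x" for n
    using rec[of "p + n + 1"] by (simp add: algebra_simps)
  let ?P = "\<lambda>s. poly (Q (int (p + s))) x =
    Psi_cur A B C p s x * poly (Q (int p)) x + Psi_prev A B C p s x * poly (Q (int p - 1)) x"
  have "?P (Suc n) \<and> ?P (Suc (Suc n))" for n
  proof (induction n)
    case 0
    have "poly (Q (int (p + 2))) x =
        S A B (p + 1) x * (S A B p x * poly (Q (int p)) x - C p * poly (Q (int p - 1)) x)
        - C (p + 1) * poly (Q (int p)) x"
      using step[of 0] step1 by simp
    with step1 show ?case by (simp add: algebra_simps)
  next
    case (Suc n)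
    then have IH: "?P (Suc n)" "?P (Suc (Suc n))" by blast+
    have "poly (Q (int (p + Suc (Suc (Suc n))))) x =
        S A B (p + n + 2) x * poly (Q (int (p + Suc (Suc n)))) x
        - C (p + n + 2) * poly (Q (int (p + Suc n))) x"
      using step[of "Suc n"] by simp
    also have "\<dots> = Psi_cur A B C p (Suc (Suc (Suc n))) x * poly (Q (int p)) x
        + Psi_prev A B C p (Suc (Suc (Suc n))) x * poly (Q (int p - 1)) x"
      unfolding IH Psi_cur.simps(4) Psi_prev.simps(4) by (simp only: algebra_simps)
    finally show ?case using IH by blast
  qed
  from this[of "s - 1"] assms(2) show ?thesis by simp
qed

end

theory Submission
  imports Defs
begin

text \<open>For fixed \<open>x\<close>, the sequences \<open>\<Psi>\<^sup>(\<^sup>p\<^sup>)\<close> and \<open>\<Psi>\<^sup>(\<^sup>p\<^sup>-\<^sup>1\<^sup>)\<close> are two solutions, in \<open>s\<close>, of the same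
  three-term recurrence, so their Casoratian (the discrete Wronskian, formed from two consecutive
  terms of each) is multiplied by a coefficient \<open>C\<^sub>i\<close> at each step. It therefore equals
  \<open>- C\<^sub>p C\<^sub>p\<^sub>+\<^sub>1 \<cdots> C\<^sub>p\<^sub>+\<^sub>s\<close> (lemma \<open>Psi_casoratian\<close>), which is nonzero because \<open>p \<ge> 1\<close>.
  Each of the three forbidden common zeros would make a row or a column of this
  2-by-2 determinant vanish.\<close>

text \<open>With the values \<open>1\<close> and \<open>0\<close> at \<open>s = 0\<close>, the three-term step already produces the entries
  at \<open>s = 2\<close>, so that no initial case has to be set apart in the induction below.\<close>

lemma Psi_cur_Suc_Suc:
  "Psi_cur A B C p (Suc (Suc s)) x =
     S A B (p + s + 1) x * Psi_cur A B C p (Suc s) x - C (p + s + 1) * Psi_cur A B C p s x"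
  by (cases s) simp_all

lemma Psi_prev_Suc_Suc:
  "Psi_prev A B C p (Suc (Suc s)) x =
     S A B (p + s + 1) x * Psi_prev A B C p (Suc s) x - C (p + s + 1) * Psi_prev A B C p s x"
  by (cases s) simp_all

text \<open>The factors \<open>S\<close> cancel in the determinant, since adding a multiple of one row to the other
  does not change it; only the coefficient of the oldest term survives.\<close>

lemma Psi_casoratian:
  "Psi_cur A B C p s x * Psi_prev A B C p (Suc s) x
     - Psi_cur A B C p (Suc s) x * Psi_prev A B C p s x = - (\<Prod>i=p..p+s. C i)"
proof (induction s)
  case 0
  show ?case by simp
next
  case (Suc s)
  have "Psi_cur A B C p (Suc s) x * Psi_prev A B C p (Suc (Suc s)) x
      - Psi_cur A B C p (Suc (Suc s)) x * Psi_prev A B C p (Suc s) x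
    = C (p + s + 1) * (Psi_cur A B C p s x * Psi_prev A B C p (Suc s) x
      - Psi_cur A B C p (Suc s) x * Psi_prev A B C p s x)"
    unfolding Psi_cur_Suc_Suc Psi_prev_Suc_Suc by (simp only: algebra_simps)
  also have "\<dots> = - (\<Prod>i=p..p + Suc s. C i)"
    unfolding Suc.IH by simp
  finally show ?case .
qed

theorem lemma1:
  fixes A B C :: "nat \<Rightarrow> real" and Q :: "int \<Rightarrow> real poly" and p :: nat
  assumes "\<forall>i. A i \<noteq> 0"
    and "\<forall>i\<ge>1. C i \<noteq> 0"
    and "\<forall>i\<ge>1. C i * A i * A (i - 1) > 0"
    and "favard_recurrence A B C Q"
    and "p \<ge> 1"
  shows "(\<forall>s\<ge>1. \<not> (\<exists>x. Psi_cur A B C p s x = 0 \<and> Psi_prev A B C p s x = 0))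
    \<and> (\<forall>s\<ge>2. \<not> (\<exists>x. Psi_cur A B C p (s - 1) x = 0 \<and> Psi_cur A B C p s x = 0))
    \<and> (\<forall>s\<ge>2. \<not> (\<exists>x. Psi_prev A B C p (s - 1) x = 0 \<and> Psi_prev A B C p s x = 0))"
proof -
  have nonzero: "Psi_cur A B C p s x * Psi_prev A B C p (Suc s) x
      - Psi_cur A B C p (Suc s) x * Psi_prev A B C p s x \<noteq> 0" for s x
    unfolding Psi_casoratian using assms(2,5) by simp
  have same_index: "\<not> (Psi_cur A B C p s x = 0 \<and> Psi_prev A B C p s x = 0)" for s x
    using nonzero[of s x] by auto
  have consecutive: "\<not> (Psi_cur A B C p (s - 1) x = 0 \<and> Psi_cur A B C p s x = 0)"
    "\<not> (Psi_prev A B C p (s - 1) x = 0 \<and> Psi_prev A B C p s x = 0)" if "s \<ge> 2" for s x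
    using nonzero[of "s - 1" x] that by auto
  show ?thesis
    using same_index consecutive by blast
qed

end
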